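(* Bipartite Activation Edge-Cover with locally uniform thresholds admits ratio $1+\bar{\omega}(\theta)$, where $\bar{\omega}(\theta)=\displaystyle\max_{k\ge1}\frac{H_k-1}{1+k/\theta}$ and $H_k=\sum_{i=1}^k 1/i$.
   Context: Bipartite Activation Edge-Cover: given a bipartite graph $G$ with sides $R$ (terminals) and $V\setminus R$, and thresholds $\{t^e_u,t^e_v\}$ per edge $e=uv$, find an assignment ${\bf a}$ of minimum $\sum_v a_v$ such that the edges $e=uv$ with $a_u\ge t^e_u,a_v\ge t^e_v$ cover $R$. Locally uniform thresholds: each non-terminal $v$ has a weight $w_v$ (threshold of $v$ on all its edges), and all edges incident to $v$ have the same threshold $t^v$ at their terminal endpoint; the instance has slope $\theta$, i.e. $w_v\le\theta t^v$. *)

theory Defs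
  imports "HOL-Analysis.Harmonic_Numbers" "HOL-Computational_Algebra.Polynomial"
    "HOL-Real_Asymp.Real_Asymp"
begin

section \<open>Bipartite Activation Edge-Cover\<close>

text \<open>
  An edge \<open>e = uv\<close> consists of its terminal endpoint \<open>u\<close>, its non-terminal endpoint \<open>v\<close>, and the
  thresholds of \<open>e\<close> at \<open>u\<close> and at \<open>v\<close>.
\<close>

record edge =
  end_t :: nat
  end_n :: nat
  thr_t :: real
  thr_n :: real

text \<open>
  The nodes are \<open>0, \<dots>, num_nodes I - 1\<close>. Edges form a list, as they are presented to an algorithm;
  parallel edges are permitted.
\<close>

record aec =
  num_nodes :: nat
  terminals :: "nat set"
  edges :: "edge list"

definition nodes :: "aec \<Rightarrow> nat set" where
  "nodes I = {..<num_nodes I}"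

definition bipartite_aec :: "aec \<Rightarrow> bool" where
  "bipartite_aec I \<longleftrightarrow>
     terminals I \<subseteq> nodes I \<and>
     (\<forall>e\<in>set (edges I). end_t e \<in> terminals I \<and> end_n e \<in> nodes I - terminals I \<and>
        0 \<le> thr_t e \<and> 0 \<le> thr_n e)"

definition activated :: "aec \<Rightarrow> (nat \<Rightarrow> real) \<Rightarrow> edge set" where
  "activated I a = {e \<in> set (edges I). thr_t e \<le> a (end_t e) \<and> thr_n e \<le> a (end_n e)}"

definition covers :: "edge set \<Rightarrow> nat set \<Rightarrow> bool" where
  "covers F R \<longleftrightarrow> (\<forall>u\<in>R. \<exists>e\<in>F. u = end_t e \<or> u = end_n e)"

definition feasible :: "aec \<Rightarrow> (nat \<Rightarrow> real) \<Rightarrow> bool" where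
  "feasible I a \<longleftrightarrow> (\<forall>v\<in>nodes I. 0 \<le> a v) \<and> covers (activated I a) (terminals I)"

definition cost :: "aec \<Rightarrow> (nat \<Rightarrow> real) \<Rightarrow> real" where
  "cost I a = (\<Sum>v\<in>nodes I. a v)"

definition opt :: "aec \<Rightarrow> real" where
  "opt I = Inf {cost I a | a. feasible I a}"

definition locally_uniform :: "aec \<Rightarrow> (nat \<Rightarrow> real) \<Rightarrow> (nat \<Rightarrow> real) \<Rightarrow> bool" where
  "locally_uniform I w t \<longleftrightarrow>
     (\<forall>e\<in>set (edges I). thr_n e = w (end_n e) \<and> thr_t e = t (end_n e))"

definition slope_at_most :: "aec \<Rightarrow> (nat \<Rightarrow> real) \<Rightarrow> (nat \<Rightarrow> real) \<Rightarrow> real \<Rightarrow> bool" where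
  "slope_at_most I w t \<theta> \<longleftrightarrow> (\<forall>v\<in>nodes I - terminals I. w v \<le> \<theta> * t v)"

definition locally_uniform_aec :: "real \<Rightarrow> aec set" where
  "locally_uniform_aec \<theta> =
     {I. bipartite_aec I \<and> (\<exists>w t. locally_uniform I w t \<and> slope_at_most I w t \<theta>)}"


section \<open>Algorithms and running time\<close>

text \<open>
  Algorithms are programs for a random access machine with finitely many arrays of natural numbers
  and finitely many arrays of reals (both kinds numbered by naturals; a scalar is cell \<open>0\<close> of an
  array). The only arithmetic is addition and subtraction (truncated on \<open>nat\<close>), and the only tests
  are comparisons. As there is no multiplication and there are no real constants other than
  natural numbers, bit lengths grow by at most a constant per step, so that on rational data a
  polynomial number of steps amounts to polynomial time on a Turing machine.
\<close>

datatype nexp =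
    NConst nat
  | NLoad nat nexp
  | NAdd nexp nexp
  | NSub nexp nexp

datatype rexp =
    RConst nat
  | RLoad nat nexp
  | RAdd rexp rexp
  | RSub rexp rexp

datatype bexp =
    NLess nexp nexp
  | RLess rexp rexp
  | BNot bexp
  | BAnd bexp bexp

datatype com =
    Skip
  | NStore nat nexp nexp
  | RStore nat nexp rexp
  | Seq com com
  | Cond bexp com com
  | While bexp com

record state =
  nmem :: "nat \<Rightarrow> nat \<Rightarrow> nat"
  rmem :: "nat \<Rightarrow> nat \<Rightarrow> real"

primrec nval :: "nexp \<Rightarrow> state \<Rightarrow> nat" where
  "nval (NConst k) s = k"
| "nval (NLoad x i) s = nmem s x (nval i s)"
| "nval (NAdd a b) s = nval a s + nval b s"
| "nval (NSub a b) s = nval a s - nval b s"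

primrec rval :: "rexp \<Rightarrow> state \<Rightarrow> real" where
  "rval (RConst k) s = real k"
| "rval (RLoad x i) s = rmem s x (nval i s)"
| "rval (RAdd a b) s = rval a s + rval b s"
| "rval (RSub a b) s = rval a s - rval b s"

primrec bval :: "bexp \<Rightarrow> state \<Rightarrow> bool" where
  "bval (NLess a b) s \<longleftrightarrow> nval a s < nval b s"
| "bval (RLess a b) s \<longleftrightarrow> rval a s < rval b s"
| "bval (BNot b) s \<longleftrightarrow> \<not> bval b s"
| "bval (BAnd a b) s \<longleftrightarrow> bval a s \<and> bval b s"

definition nstore :: "nat \<Rightarrow> nat \<Rightarrow> nat \<Rightarrow> state \<Rightarrow> state" where
  "nstore x i k s = s\<lparr>nmem := (nmem s)(x := (nmem s x)(i := k))\<rparr>"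

definition rstore :: "nat \<Rightarrow> nat \<Rightarrow> real \<Rightarrow> state \<Rightarrow> state" where
  "rstore x i r s = s\<lparr>rmem := (rmem s)(x := (rmem s x)(i := r))\<rparr>"

text \<open>
  \<open>exec c s T s'\<close>: started in \<open>s\<close>, the program \<open>c\<close> halts in \<open>s'\<close> after \<open>T\<close> steps. Every
  assignment and every test costs one step; the expressions in a program are of fixed size, so
  counting individual operations would only change \<open>T\<close> by a constant factor depending on \<open>c\<close>.
\<close>

inductive exec :: "com \<Rightarrow> state \<Rightarrow> nat \<Rightarrow> state \<Rightarrow> bool" where
  Skip: "exec Skip s 1 s"
| NStore: "exec (NStore x i a) s 1 (nstore x (nval i s) (nval a s) s)"
| RStore: "exec (RStore x i a) s 1 (rstore x (nval i s) (rval a s) s)"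
| Seq: "exec c s T s' \<Longrightarrow> exec d s' T' s'' \<Longrightarrow> exec (Seq c d) s (T + T') s''"
| CondTrue: "bval b s \<Longrightarrow> exec c s T s' \<Longrightarrow> exec (Cond b c d) s (Suc T) s'"
| CondFalse: "\<not> bval b s \<Longrightarrow> exec d s T s' \<Longrightarrow> exec (Cond b c d) s (Suc T) s'"
| WhileFalse: "\<not> bval b s \<Longrightarrow> exec (While b c) s 1 s"
| WhileTrue: "bval b s \<Longrightarrow> exec c s T s' \<Longrightarrow> exec (While b c) s' T' s'' \<Longrightarrow>
    exec (While b c) s (Suc (T + T')) s''"

inductive_cases exec_SkipE: "exec Skip s T s'"
inductive_cases exec_NStoreE: "exec (NStore x i a) s T s'"
inductive_cases exec_RStoreE: "exec (RStore x i a) s T s'"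
inductive_cases exec_SeqE: "exec (Seq c d) s T s'"
inductive_cases exec_CondE: "exec (Cond b c d) s T s'"
inductive_cases exec_WhileE: "exec (While b c) s T s'"

lemma exec_deterministic:
  assumes "exec c s T s'" and "exec c s U s''"
  shows "T = U \<and> s' = s''"
  using assms
proof (induction arbitrary: U s'' rule: exec.induct)
  case (Seq c s T s' d T' s1)
  from Seq.prems obtain V V' r where "exec c s V r" "exec d r V' s''" "U = V + V'"
    by (rule exec_SeqE)
  with Seq.IH show ?case by metis
next
  case (CondTrue b s c T s' d)
  from CondTrue.prems obtain V where "exec c s V s''" "U = Suc V"
    by (rule exec_CondE) (use CondTrue.hyps in auto)
  with CondTrue.IH show ?case by metis
next
  case (CondFalse b s d T s' c)
  from CondFalse.prems obtain V where "exec d s V s''" "U = Suc V"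
    by (rule exec_CondE) (use CondFalse.hyps in auto)
  with CondFalse.IH show ?case by metis
next
  case (WhileFalse b s c)
  from WhileFalse.prems show ?case
    by (rule exec_WhileE) (use WhileFalse.hyps in auto)
next
  case (WhileTrue b s c T s' T' s1)
  from WhileTrue.prems obtain V V' r
    where "exec c s V r" "exec (While b c) r V' s''" "U = Suc (V + V')"
    by (rule exec_WhileE) (use WhileTrue.hyps in auto)
  with WhileTrue.IH show ?case by metis
qed (auto elim: exec_SkipE exec_NStoreE exec_RStoreE)

text \<open>
  Input: \<open>nat\<close> array 0 holds the numbers of nodes and of edges, array 1 the characteristic function
  of the terminals, arrays 2 and 3 the terminal and non-terminal endpoints of the edges, and real
  arrays 0 and 1 the thresholds at these endpoints. Output: the assignment in real array 2.
\<close>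

definition init :: "aec \<Rightarrow> state" where
  "init I = \<lparr>
     nmem = (\<lambda>_ _. 0)(
       0 := (\<lambda>_. 0)(0 := num_nodes I, 1 := length (edges I)),
       1 := (\<lambda>v. if v \<in> terminals I then 1 else 0),
       2 := (\<lambda>j. if j < length (edges I) then end_t (edges I ! j) else 0),
       3 := (\<lambda>j. if j < length (edges I) then end_n (edges I ! j) else 0)),
     rmem = (\<lambda>_ _. 0)(
       0 := (\<lambda>j. if j < length (edges I) then thr_t (edges I ! j) else 0),
       1 := (\<lambda>j. if j < length (edges I) then thr_n (edges I ! j) else 0))\<rparr>"

definition result :: "state \<Rightarrow> nat \<Rightarrow> real" where
  "result s = rmem s 2"

definition input_size :: "aec \<Rightarrow> nat" where
  "input_size I = num_nodes I + length (edges I)"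

text \<open>
  \<open>c\<close> is a \<open>\<rho>\<close>-approximation algorithm on the class \<open>\<C>\<close> with running time bounded by the
  polynomial \<open>p\<close>. As usual, only instances that have a feasible solution are considered.
\<close>

definition approximates :: "com \<Rightarrow> nat poly \<Rightarrow> aec set \<Rightarrow> real \<Rightarrow> bool" where
  "approximates c p \<C> \<rho> \<longleftrightarrow>
     (\<forall>I\<in>\<C>. (\<exists>a. feasible I a) \<longrightarrow>
        (\<exists>T s. exec c (init I) T s \<and> T \<le> poly p (input_size I) \<and>
           feasible I (result s) \<and> cost I (result s) \<le> \<rho> * opt I))"


section \<open>The ratio\<close>

definition omega_bar :: "real \<Rightarrow> real" where
  "omega_bar \<theta> = (SUP k\<in>{1::nat..}. (harm k - 1) / (1 + real k / \<theta>))"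

text \<open>The supremum is a maximum.\<close>

lemma omega_bar_attained:
  assumes "\<theta> > 0"
  obtains k :: nat where "k \<ge> 1"
    and "omega_bar \<theta> = (harm k - 1) / (1 + real k / \<theta>)"
    and "\<And>j::nat. j \<ge> 1 \<Longrightarrow> (harm j - 1) / (1 + real j / \<theta>) \<le> (harm k - 1) / (1 + real k / \<theta>)"
proof -
  define f :: "nat \<Rightarrow> real" where "f k = (harm k - 1) / (1 + real k / \<theta>)" for k
  have l1: "(\<lambda>k. (harm k - ln (real k)) / real k) \<longlonglongrightarrow> 0"
    by (rule tendsto_divide_0[OF euler_mascheroni_LIMSEQ])
      (rule filterlim_at_top_imp_at_infinity[OF filterlim_real_sequentially])
  have l2: "(\<lambda>k. ln (real k) / real k) \<longlonglongrightarrow> 0" and l3: "(\<lambda>k. 1 / real k) \<longlonglongrightarrow> 0"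
    by real_asymp+
  have "(\<lambda>k. ((harm k - ln (real k)) / real k + ln (real k) / real k - 1 / real k) /
      (1 / real k + 1 / \<theta>)) \<longlonglongrightarrow> (0 + 0 - 0) / (0 + 1 / \<theta>)"
    by (rule tendsto_divide[OF tendsto_diff[OF tendsto_add[OF l1 l2] l3]
          tendsto_add[OF l3 tendsto_const]]) (use assms in simp)
  moreover have "\<forall>\<^sub>F k in sequentially.
      ((harm k - ln (real k)) / real k + ln (real k) / real k - 1 / real k) /
      (1 / real k + 1 / \<theta>) = f k"
    using eventually_gt_at_top[of 0]
  proof eventually_elim
    case (elim k)
    have "(harm k - ln (real k)) / real k + ln (real k) / real k - 1 / real k = (harm k - 1) / real k"
      by (simp add: diff_divide_distrib)
    moreover have "1 / real k + 1 / \<theta> = (1 + real k / \<theta>) / real k"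
      using elim by (simp add: field_simps)
    ultimately show ?case using elim by (simp add: f_def)
  qed
  ultimately have lim: "f \<longlonglongrightarrow> 0"
    by (simp add: tendsto_cong)
  have "f 2 > 0"
    using assms by (simp add: f_def harm_expand add_pos_pos)
  with lim have "\<forall>\<^sub>F k in sequentially. f k < f 2"
    by (rule order_tendstoD)
  then obtain N where N: "\<And>k. k \<ge> N \<Longrightarrow> f k < f 2"
    by (auto simp: eventually_sequentially)
  define M where "M = Max (f ` {1..N + 2})"
  have "M \<in> f ` {1..N + 2}"
    unfolding M_def by (rule Max_in) auto
  then obtain k where k: "k \<ge> 1" "f k = M" by auto
  have le: "f j \<le> f k" if "j \<ge> 1" for j
  proof (cases "j \<le> N + 2")
    case True
    then show ?thesis using that k(2) unfolding M_def by (auto intro!: Max_ge)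
  next
    case False
    then have "f j < f 2" using N by simp
    also have "f 2 \<le> M" unfolding M_def by (auto intro!: Max_ge)
    finally show ?thesis using k by simp
  qed
  have "omega_bar \<theta> = f k"
    unfolding omega_bar_def f_def[symmetric]
    by (rule cSup_eq_maximum) (use k le in auto)
  then show ?thesis
    using that k le by (simp add: f_def)
qed

end

theory Submission
  imports Defs
begin

text \<open>
  The algorithm is greedy set cover: while the set \<open>U\<close> of uncovered terminals is nonempty, buy the
  star that minimises the price per newly covered terminal. By local uniformity it is best to take
  all uncovered neighbours of a centre \<open>v\<close>, so this price is \<open>t v + w v / |nbrs v \<inter> U|\<close>.
  An optimal solution splits the terminals into stars. When \<open>i\<close> terminals of such a star with centre
  \<open>v\<close> are still uncovered, greedy pays at most \<open>t v + w v / i\<close> for each terminal it covers, so a star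
  with \<open>k\<close> leaves is charged at most \<open>k t v + w v H\<^sub>k\<close>, whereas the optimum pays \<open>k t v + w v\<close>. With
  \<open>w v \<le> \<theta> t v\<close> the quotient is at most \<open>1 + (H\<^sub>k - 1) / (1 + k / \<theta>)\<close>.
\<close>

section \<open>The greedy bound\<close>

definition nbrs :: "aec \<Rightarrow> nat \<Rightarrow> nat set" where
  "nbrs I v = end_t ` {e \<in> set (edges I). end_n e = v}"

definition star_price :: "aec \<Rightarrow> (nat \<Rightarrow> real) \<Rightarrow> (nat \<Rightarrow> real) \<Rightarrow> nat set \<Rightarrow> nat \<Rightarrow> real" where
  "star_price I w t U v = t v + w v / real (card (nbrs I v \<inter> U))"

text \<open>Stars without uncovered leaves must be excluded: division by zero would give them the
  price \<open>t v\<close>.\<close>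

definition cheapest :: "aec \<Rightarrow> (nat \<Rightarrow> real) \<Rightarrow> (nat \<Rightarrow> real) \<Rightarrow> nat set \<Rightarrow> nat \<Rightarrow> bool" where
  "cheapest I w t U v \<longleftrightarrow> nbrs I v \<inter> U \<noteq> {} \<and>
     (\<forall>v'. nbrs I v' \<inter> U \<noteq> {} \<longrightarrow> star_price I w t U v \<le> star_price I w t U v')"

text \<open>\<open>g\<close> assigns to each terminal the centre of its star in the solution that is compared with.\<close>

definition potential ::
  "(nat \<Rightarrow> real) \<Rightarrow> (nat \<Rightarrow> real) \<Rightarrow> (nat \<Rightarrow> nat) \<Rightarrow> nat set \<Rightarrow> nat set \<Rightarrow> real" where
  "potential w t g S U =
     (\<Sum>v\<in>S. real (card {u\<in>U. g u = v}) * t v + w v * harm (card {u\<in>U. g u = v}))"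

text \<open>Each of the \<open>d\<close> summands \<open>1/(n+1), ..., 1/(n+d)\<close> of the
  difference is at least \<open>1/(n+d)\<close>.\<close>

lemma harm_diff_ge:
  "real d / real (n + d) \<le> (harm (n + d) - harm n :: real)"
proof (induction d)
  case (Suc d)
  have "real d / real (n + Suc d) \<le> real d / real (n + d)"
    by (cases "d = 0") (auto intro!: divide_left_mono)
  moreover have "real (Suc d) / real (n + Suc d) = real d / real (n + Suc d) + 1 / real (n + Suc d)"
    by (simp add: add_divide_distrib)
  ultimately show ?case
    using Suc by (simp add: harm_Suc inverse_eq_divide)
qed simp

lemma card_eq_sum_fibres:
  assumes "finite S" "finite U" "g ` U \<subseteq> S"
  shows "card U = (\<Sum>v\<in>S. card {u\<in>U. g u = v})"
proof -
  have "(\<Sum>v\<in>S. \<Sum>u\<in>{u\<in>U. g u = v}. 1::nat) = (\<Sum>u\<in>U. 1)"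
    by (rule sum.group) (use assms in auto)
  then show ?thesis by simp
qed

text \<open>Argue fibre by fibre: a star with \<open>b + d\<close> uncovered leaves,
  \<open>d\<close> of them in \<open>D\<close>, loses
  \<open>d * t v + w v * (harm (b + d) - harm b)\<close>. By \<open>harm_diff_ge\<close> this is at
  least \<open>d * (t v + w v / (b + d))\<close>, hence at least \<open>d * p\<close>. With
  \<open>p\<close> the price of greedy's star, the drop pays for a round.\<close>

lemma potential_drop:
  assumes fin: "finite S" "finite U" and g: "g ` U \<subseteq> S" and D: "D \<subseteq> U"
    and w: "\<And>u. u \<in> U \<Longrightarrow> 0 \<le> w (g u)"
    and p: "\<And>u. u \<in> U \<Longrightarrow> p \<le> t (g u) + w (g u) / real (card {u'\<in>U. g u' = g u})"
  shows "real (card D) * p + potential w t g S (U - D) \<le> potential w t g S U"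
proof -
  have "real (card D) * p = (\<Sum>v\<in>S. real (card {u\<in>D. g u = v}) * p)"
  proof -
    have "finite D" "g ` D \<subseteq> S" using fin g D finite_subset by auto
    from card_eq_sum_fibres[OF fin(1) this] show ?thesis
      by (simp add: sum_distrib_right)
  qed
  moreover have "real (card {u\<in>D. g u = v}) * p
      + (real (card {u\<in>U - D. g u = v}) * t v + w v * harm (card {u\<in>U - D. g u = v}))
      \<le> real (card {u\<in>U. g u = v}) * t v + w v * harm (card {u\<in>U. g u = v})" for v
  \<comment> \<open>The bounds on \<open>w\<close> and \<open>p\<close> are available only for
    centres with a leaf in \<open>U\<close>; an empty fibre contributes \<open>0\<close> to both
    sides.\<close>
  proof (cases "{u\<in>U. g u = v} = {}")
    case True
    then have eq: "{u\<in>D. g u = v} = {}" "{u\<in>U - D. g u = v} = {}" using D by auto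
    show ?thesis unfolding True eq by (simp add: harm_expand)
  next
    case False
    then obtain u where u: "u \<in> U" "g u = v" by auto
    define d b where "d = card {u\<in>D. g u = v}" and "b = card {u\<in>U - D. g u = v}"
    have "{u\<in>U. g u = v} = {u\<in>U - D. g u = v} \<union> {u\<in>D. g u = v}" using D by auto
    then have card: "card {u\<in>U. g u = v} = b + d"
      unfolding d_def b_def
      by (simp only:) (rule card_Un_disjoint, use fin D in \<open>auto intro: finite_subset\<close>)
    have "real d * p \<le> real d * (t v + w v / real (b + d))"
      using p[OF u(1)] u card by (intro mult_left_mono) auto
    also have "\<dots> = real d * t v + w v * (real d / real (b + d))"
      by (simp add: algebra_simps)
    also have "\<dots> \<le> real d * t v + w v * (harm (b + d) - harm b)"
      using w[OF u(1)] u harm_diff_ge[of d b] by (intro add_left_mono mult_left_mono) auto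
    finally show ?thesis
      unfolding card d_def[symmetric] b_def[symmetric] by (simp add: algebra_simps)
  qed
  ultimately show ?thesis
    unfolding potential_def by (simp add: sum.distrib[symmetric] sum_mono)
qed

section \<open>From the potential of one star to the ratio\<close>

lemma omega_bar_ge:
  assumes "\<theta> > 0" "k \<ge> (1::nat)"
  shows "(harm k - 1) / (1 + real k / \<theta>) \<le> omega_bar \<theta>"
  using omega_bar_attained[OF assms(1)] assms(2) by metis

lemma omega_bar_nonneg:
  assumes "\<theta> > 0"
  shows "0 \<le> omega_bar \<theta>"
  using omega_bar_ge[OF assms, of 1] by (simp add: harm_expand)

text \<open>Write the left side as \<open>(w + k * t) + w * (harm k - 1)\<close>. The definition of
  \<open>omega_bar\<close> bounds the surplus by
  \<open>omega_bar \<theta> * (w + k * (w / \<theta>))\<close>, and the slope replaces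
  \<open>w / \<theta>\<close> by \<open>t\<close>.\<close>

lemma star_potential_le:
  fixes w t :: real
  assumes \<theta>: "\<theta> > 0" and w: "0 \<le> w" "w \<le> \<theta> * t" and k: "k \<ge> (1::nat)"
  shows "real k * t + w * harm k \<le> (1 + omega_bar \<theta>) * (w + real k * t)"
proof -
  have pos: "1 + real k / \<theta> > 0" using \<theta> by (simp add: add_pos_nonneg)
  have "harm k - 1 \<le> omega_bar \<theta> * (1 + real k / \<theta>)"
    using omega_bar_ge[OF \<theta> k] pos by (simp add: pos_divide_le_eq)
  then have "w * (harm k - 1) \<le> w * (omega_bar \<theta> * (1 + real k / \<theta>))"
    using w by (intro mult_left_mono) auto
  also have "\<dots> = omega_bar \<theta> * (w + real k * (w / \<theta>))"
    by (simp add: algebra_simps)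
  also have "\<dots> \<le> omega_bar \<theta> * (w + real k * t)"
    using omega_bar_nonneg[OF \<theta>] w \<theta>
    by (intro mult_left_mono add_left_mono) (auto simp: pos_divide_le_eq mult.commute)
  finally show ?thesis by (simp add: algebra_simps)
qed

section \<open>The greedy cover: invariant and cost\<close>

locale uniform_instance =
  fixes I :: aec and w t :: "nat \<Rightarrow> real"
  assumes bipartite: "bipartite_aec I" and uniform: "locally_uniform I w t"
begin

abbreviation "R \<equiv> terminals I"
abbreviation "S \<equiv> nodes I - terminals I"

lemma finite_nodes [simp]: "finite (nodes I)"
  by (simp add: nodes_def)

lemma R_nodes: "R \<subseteq> nodes I"
  using bipartite by (simp add: bipartite_aec_def)

lemma finite_R [simp]: "finite R"
  using R_nodes finite_nodes by (rule finite_subset)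

lemma edgeD:
  assumes "e \<in> set (edges I)"
  shows "end_t e \<in> R" "end_n e \<in> S" "thr_t e = t (end_n e)" "thr_n e = w (end_n e)"
    "0 \<le> t (end_n e)" "0 \<le> w (end_n e)"
  using assms bipartite uniform by (auto simp: bipartite_aec_def locally_uniform_def)

lemma nbrsE:
  assumes "u \<in> nbrs I v"
  obtains e where "e \<in> set (edges I)" "end_t e = u" "end_n e = v"
  using assms by (auto simp: nbrs_def)

lemma nbrsI: "e \<in> set (edges I) \<Longrightarrow> end_t e \<in> nbrs I (end_n e)"
  by (auto simp: nbrs_def)

lemma nbrs_weights:
  assumes "u \<in> nbrs I v"
  shows "u \<in> R" "v \<in> S" "0 \<le> t v" "0 \<le> w v"
  using assms by (auto elim!: nbrsE dest: edgeD)

text \<open>Amortised accounting: the money spent plus the potential of what is still uncovered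
  never exceeds the initial potential. All assignments \<open>g\<close> of terminals to adjacent
  centres are quantified over, because the solution to compare with is chosen only after the
  run.\<close>

definition greedy_inv :: "nat set \<Rightarrow> (nat \<Rightarrow> real) \<Rightarrow> bool" where
  "greedy_inv U A \<longleftrightarrow> U \<subseteq> R \<and> (\<forall>v. 0 \<le> A v) \<and>
     (\<forall>u\<in>R - U. \<exists>e\<in>activated I A. end_t e = u) \<and>
     (\<forall>g. (\<forall>u\<in>R. u \<in> nbrs I (g u)) \<longrightarrow> cost I A + potential w t g S U \<le> potential w t g S R)"

lemma greedy_inv_start: "greedy_inv R (\<lambda>_. 0)"
  by (simp add: greedy_inv_def cost_def)

text \<open>The payment \<open>w v + card D * t v\<close> is \<open>card D\<close> times the price
  of the star, which the potential drop absorbs because no star of \<open>g\<close> is cheaper.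
  Overwriting \<open>A\<close> is safe: by local uniformity every edge at \<open>v\<close> asks for
  exactly \<open>w v\<close> there.\<close>

lemma greedy_inv_step:
  assumes inv: "greedy_inv U A" and v: "cheapest I w t U v"
    and A': "A' = (\<lambda>x. if x \<in> nbrs I v \<inter> U then t v else if x = v then w v else A x)"
  shows "greedy_inv (U - nbrs I v) A'"
proof -
  define D where "D = nbrs I v \<inter> U"
  have UR: "U \<subseteq> R" and A0: "\<And>x. 0 \<le> A x"
    and cov: "\<And>u. u \<in> R - U \<Longrightarrow> \<exists>e\<in>activated I A. end_t e = u"
    and pot: "\<And>g. (\<forall>u\<in>R. u \<in> nbrs I (g u)) \<Longrightarrow>
        cost I A + potential w t g S U \<le> potential w t g S R"
    using inv by (auto simp: greedy_inv_def)
  have ne: "D \<noteq> {}" using v by (simp add: cheapest_def D_def)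
  then have vS: "v \<in> S" and t0: "0 \<le> t v" and w0: "0 \<le> w v"
    using nbrs_weights[of _ v] by (auto simp: D_def)
  have finU: "finite U" using UR finite_R by (rule finite_subset)
  then have finD: "finite D" and DU: "D \<subseteq> U" by (auto simp: D_def)
  have DR: "D \<subseteq> R" using DU UR by auto
  have vD: "v \<notin> D" using DR vS by auto
  have A'0: "0 \<le> A' x" for x using A0 t0 w0 by (simp add: A')
  have cov': "\<exists>e\<in>activated I A'. end_t e = u" if u: "u \<in> R - (U - nbrs I v)" for u
  proof (cases "u \<in> D")
    case True
    then obtain e where e: "e \<in> set (edges I)" "end_t e = u" "end_n e = v"
      by (auto simp: D_def elim: nbrsE)
    then have "e \<in> activated I A'"
      using True vD by (auto simp: activated_def A' D_def edgeD)
    then show ?thesis using e by auto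
  next
    case False
    then have "u \<in> R - U" using u by (auto simp: D_def)
    then obtain e where e: "e \<in> activated I A" "end_t e = u" using cov by blast
    then have eE: "e \<in> set (edges I)" by (simp add: activated_def)
    \<comment> \<open>An old edge stays active: its leaf is untouched, and its centre either keeps
      its value or is \<open>v\<close> and gets exactly the threshold \<open>w v\<close>.\<close>
    have "u \<noteq> v" "end_n e \<notin> D" using edgeD[OF eE] e vS \<open>u \<in> R - U\<close> DR by auto
    then have "e \<in> activated I A'"
      using e False edgeD(4)[OF eE] by (auto simp: activated_def A' D_def[symmetric])
    then show ?thesis using e by auto
  qed
  have cost: "cost I A' \<le> cost I A + (w v + real (card D) * t v)"
  proof -
    have "cost I A' \<le> (\<Sum>x\<in>nodes I. A x + ((if x = v then w v else 0) + (if x \<in> D then t v else 0)))"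
      unfolding cost_def A' D_def[symmetric] using A0 t0 w0 vD by (intro sum_mono) auto
    also have "\<dots> = cost I A + (w v + real (card D) * t v)"
    proof -
      have "v \<in> nodes I" using vS by auto
      moreover have "nodes I \<inter> D = D" using DR R_nodes by auto
      ultimately show ?thesis
        by (simp add: sum.distrib cost_def sum.If_cases)
    qed
    finally show ?thesis .
  qed
  have "cost I A' + potential w t g S (U - nbrs I v) \<le> potential w t g S R"
    if g: "\<forall>u\<in>R. u \<in> nbrs I (g u)" for g
  proof -
    have "real (card D) * star_price I w t U v + potential w t g S (U - D) \<le> potential w t g S U"
    proof (rule potential_drop)
      show "g ` U \<subseteq> S" using g UR nbrs_weights by blast
      show "0 \<le> w (g u)" if "u \<in> U" for u using that g UR nbrs_weights by blast
      fix u assume u: "u \<in> U"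
      then have un: "u \<in> nbrs I (g u)" using g UR by auto
      \<comment> \<open>The fibre of \<open>g u\<close> may miss some uncovered neighbours of
        \<open>g u\<close>; including them only lowers the price that greedy compares with.\<close>
      have sub: "{u'\<in>U. g u' = g u} \<subseteq> nbrs I (g u) \<inter> U" using g UR by force
      have "card {u'\<in>U. g u' = g u} \<le> card (nbrs I (g u) \<inter> U)"
        using sub finU by (intro card_mono) auto
      moreover have "0 < card {u'\<in>U. g u' = g u}"
        using u finU by (auto simp: card_gt_0_iff)
      ultimately have "w (g u) / real (card (nbrs I (g u) \<inter> U)) \<le> w (g u) / real (card {u'\<in>U. g u' = g u})"
        using nbrs_weights(4)[OF un] by (intro divide_left_mono) auto
      moreover have "star_price I w t U v \<le> star_price I w t U (g u)"
        using v un u by (auto simp: cheapest_def)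
      ultimately show "star_price I w t U v \<le> t (g u) + w (g u) / real (card {u'\<in>U. g u' = g u})"
        by (simp add: star_price_def)
    qed (use finU DU in auto)
    moreover have "real (card D) * star_price I w t U v = w v + real (card D) * t v"
      using ne finD by (simp add: star_price_def D_def[symmetric] field_simps)
    moreover have "U - D = U - nbrs I v" by (auto simp: D_def)
    ultimately show ?thesis using cost pot[OF g] by simp
  qed
  then show ?thesis
    unfolding greedy_inv_def using UR A'0 cov' by blast
qed

lemma greedy_inv_feasible:
  assumes "greedy_inv {} A"
  shows "feasible I A"
  using assms unfolding greedy_inv_def feasible_def covers_def by auto

text \<open>Let \<open>g\<close> send each terminal to the centre of an edge that \<open>a\<close>
  activates at it. The fibres of \<open>g\<close> are stars, \<open>star_potential_le\<close> bounds
  the initial potential star by star, and \<open>a\<close> pays at least \<open>w v\<close> at each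
  centre used and at least \<open>t (g u)\<close> at each terminal \<open>u\<close>.\<close>

lemma greedy_inv_cost:
  assumes inv: "greedy_inv {} A" and slope: "slope_at_most I w t \<theta>" and \<theta>: "\<theta> > 0"
    and a: "feasible I a"
  shows "cost I A \<le> (1 + omega_bar \<theta>) * cost I a"
proof -
  \<comment> \<open>\<open>covers\<close> allows \<open>u\<close> to be either endpoint;
    bipartiteness forces the terminal one.\<close>
  have "\<exists>e. e \<in> activated I a \<and> u = end_t e" if "u \<in> R" for u
    using a that edgeD(2) by (fastforce simp: feasible_def covers_def activated_def)
  then obtain f where f: "\<And>u. u \<in> R \<Longrightarrow> f u \<in> activated I a \<and> u = end_t (f u)" by metis
  define g where "g u = end_n (f u)" for u
  have fE: "f u \<in> set (edges I)" if "u \<in> R" for u using f[OF that] by (simp add: activated_def)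
  have g: "\<forall>u\<in>R. u \<in> nbrs I (g u)" using f fE nbrsI g_def by metis
  have gS: "g ` R \<subseteq> S" using g nbrs_weights by blast
  have au: "t (g u) \<le> a u" "w (g u) \<le> a (g u)" if "u \<in> R" for u
    using f[OF that] edgeD[OF fE[OF that]] by (auto simp: activated_def g_def)
  have a0: "\<And>x. x \<in> nodes I \<Longrightarrow> 0 \<le> a x" using a by (simp add: feasible_def)
  define b where "b v = card {u\<in>R. g u = v}" for v
  have "cost I A + potential w t g S {} \<le> potential w t g S R"
    using inv g by (simp add: greedy_inv_def)
  then have "cost I A \<le> potential w t g S R"
    by (simp add: potential_def harm_expand)
  also have "\<dots> \<le> (\<Sum>v\<in>S. (1 + omega_bar \<theta>) * (a v + real (b v) * t v))"
    unfolding potential_def b_def[symmetric]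
  proof (rule sum_mono)
    fix v assume v: "v \<in> S"
    show "real (b v) * t v + w v * harm (b v) \<le> (1 + omega_bar \<theta>) * (a v + real (b v) * t v)"
    proof (cases "b v = 0")
      \<comment> \<open>A centre without leaves has potential \<open>0\<close> whatever the sign of
        its weight, as \<open>harm 0 = 0\<close>.\<close>
      case True
      then show ?thesis
        using omega_bar_nonneg[OF \<theta>] a0 v by (simp add: harm_expand)
    next
      case False
      then have "{u\<in>R. g u = v} \<noteq> {}" unfolding b_def by (metis card.empty)
      then obtain u where u: "u \<in> R" "g u = v" by auto
      have "0 \<le> w v" using g u nbrs_weights by blast
      moreover have "w v \<le> \<theta> * t v" using slope v by (simp add: slope_at_most_def)
      ultimately have "real (b v) * t v + w v * harm (b v) \<le> (1 + omega_bar \<theta>) * (w v + real (b v) * t v)"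
        using False by (intro star_potential_le \<theta>) auto
      also have "\<dots> \<le> (1 + omega_bar \<theta>) * (a v + real (b v) * t v)"
        using au(2)[OF u(1)] u omega_bar_nonneg[OF \<theta>] by (intro mult_left_mono) auto
      finally show ?thesis .
    qed
  qed
  also have "\<dots> = (1 + omega_bar \<theta>) * ((\<Sum>v\<in>S. a v) + (\<Sum>v\<in>S. real (b v) * t v))"
    by (simp only: sum_distrib_left sum.distrib distrib_left)
  also have "(\<Sum>v\<in>S. real (b v) * t v) = (\<Sum>v\<in>S. \<Sum>u\<in>{u\<in>R. g u = v}. t (g u))"
    by (intro sum.cong) (auto simp: b_def)
  also have "\<dots> = (\<Sum>u\<in>R. t (g u))"
    by (rule sum.group) (use gS in auto)
  also have "(1 + omega_bar \<theta>) * ((\<Sum>v\<in>S. a v) + (\<Sum>u\<in>R. t (g u)))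
      \<le> (1 + omega_bar \<theta>) * ((\<Sum>v\<in>S. a v) + (\<Sum>u\<in>R. a u))"
    using omega_bar_nonneg[OF \<theta>] au by (intro mult_left_mono add_left_mono sum_mono) auto
  also have "(\<Sum>v\<in>S. a v) + (\<Sum>u\<in>R. a u) = cost I a"
    unfolding cost_def by (rule sum.subset_diff[symmetric]) (use R_nodes in auto)
  finally show ?thesis .
qed

lemma greedy_inv_opt:
  assumes inv: "greedy_inv {} A" and slope: "slope_at_most I w t \<theta>" and \<theta>: "\<theta> > 0"
  shows "cost I A \<le> (1 + omega_bar \<theta>) * opt I"
proof -
  have pos: "1 + omega_bar \<theta> > 0" using omega_bar_nonneg[OF \<theta>] by simp
  \<comment> \<open>\<open>opt I\<close> is an infimum, so it is enough to bound all feasible costs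
    from below; greedy's own output shows that there are some.\<close>
  have "cost I A / (1 + omega_bar \<theta>) \<le> opt I"
    unfolding opt_def
  proof (rule cInf_greatest)
    show "{cost I a |a. feasible I a} \<noteq> {}" using greedy_inv_feasible[OF inv] by auto
    show "cost I A / (1 + omega_bar \<theta>) \<le> c" if "c \<in> {cost I a |a. feasible I a}" for c
      using that greedy_inv_cost[OF inv slope \<theta>] pos by (auto simp: pos_divide_le_eq mult.commute)
  qed
  then show ?thesis using pos by (simp add: pos_divide_le_eq mult.commute)
qed

end


section \<open>Total correctness with running time\<close>

text \<open>Hoare triple for total correctness with a step bound. In the form
  \<open>K * M ^ d\<close>, nesting a loop of fewer than \<open>M\<close> rounds raises
  \<open>d\<close> by one and \<open>K\<close> by a constant.\<close>

definition triple ::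
  "nat \<Rightarrow> nat \<Rightarrow> nat \<Rightarrow> (state \<Rightarrow> bool) \<Rightarrow> com \<Rightarrow> (state \<Rightarrow> bool) \<Rightarrow> bool" where
  "triple M K d P c Q \<longleftrightarrow>
     (\<forall>s. P s \<longrightarrow> (\<exists>T s'. exec c s T s' \<and> T \<le> K * M ^ d \<and> Q s'))"

primrec loop_free :: "com \<Rightarrow> bool" where
  "loop_free Skip \<longleftrightarrow> True"
| "loop_free (NStore x i a) \<longleftrightarrow> True"
| "loop_free (RStore x i a) \<longleftrightarrow> True"
| "loop_free (Seq c d) \<longleftrightarrow> loop_free c \<and> loop_free d"
| "loop_free (Cond b c d) \<longleftrightarrow> loop_free c \<and> loop_free d"
| "loop_free (While b c) \<longleftrightarrow> False"

text \<open>Loop-free code as a function on states, so that simplification evaluates it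
  symbolically. The \<open>While\<close> clause is a dummy, ruled out by
  \<open>loop_free\<close>.\<close>

primrec run :: "com \<Rightarrow> state \<Rightarrow> state" where
  "run Skip s = s"
| "run (NStore x i a) s = nstore x (nval i s) (nval a s) s"
| "run (RStore x i a) s = rstore x (nval i s) (rval a s) s"
| "run (Seq c d) s = run d (run c s)"
| "run (Cond b c d) s = (if bval b s then run c s else run d s)"
| "run (While b c) s = s"

primrec max_steps :: "com \<Rightarrow> nat" where
  "max_steps Skip = 1"
| "max_steps (NStore x i a) = 1"
| "max_steps (RStore x i a) = 1"
| "max_steps (Seq c d) = max_steps c + max_steps d"
| "max_steps (Cond b c d) = 1 + max_steps c + max_steps d"
| "max_steps (While b c) = 0"

lemma exec_run:
  assumes "loop_free c"
  shows "\<exists>T \<le> max_steps c. exec c s T (run c s)"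
  using assms
proof (induction c arbitrary: s)
  case (Seq c d)
  from Seq.prems have lf: "loop_free c" "loop_free d" by simp_all
  obtain T where "T \<le> max_steps c" "exec c s T (run c s)" using Seq.IH(1)[OF lf(1)] by blast
  moreover obtain T' where "T' \<le> max_steps d" "exec d (run c s) T' (run d (run c s))"
    using Seq.IH(2)[OF lf(2)] by blast
  ultimately show ?case by (auto intro!: exI[of _ "T + T'"] exec.intros)
next
  case (Cond b c d)
  from Cond.prems have lf: "loop_free c" "loop_free d" by simp_all
  obtain T where "T \<le> max_steps c" "exec c s T (run c s)" using Cond.IH(1)[OF lf(1)] by blast
  moreover obtain T' where "T' \<le> max_steps d" "exec d s T' (run d s)"
    using Cond.IH(2)[OF lf(2)] by blast
  ultimately show ?case
    by (cases "bval b s") (auto intro: exI[of _ "Suc T"] exI[of _ "Suc T'"] exec.intros)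
next
  case Skip
  show ?case using exec.Skip by (intro exI[of _ 1]) simp
next
  case (NStore x i a)
  show ?case using exec.NStore by (intro exI[of _ 1]) simp
next
  case (RStore x i a)
  show ?case using exec.RStore by (intro exI[of _ 1]) simp
qed simp

lemma triple_loop_free:
  assumes "loop_free c" "\<And>s. P s \<Longrightarrow> Q (run c s)" "max_steps c \<le> K" "1 \<le> M"
  shows "triple M K d P c Q"
  unfolding triple_def
proof (intro allI impI)
  fix s assume "P s"
  obtain T where T: "T \<le> max_steps c" "exec c s T (run c s)" using exec_run[OF assms(1)] by blast
  have "K * 1 \<le> K * M ^ d" using assms(4) by (intro mult_left_mono) auto
  then have "T \<le> K * M ^ d" using T(1) assms(3) by linarith
  then show "\<exists>T s'. exec c s T s' \<and> T \<le> K * M ^ d \<and> Q s'" using T assms(2)[OF \<open>P s\<close>] by blast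
qed

lemma triple_conseq:
  assumes "triple M K d P c Q" "\<And>s. P' s \<Longrightarrow> P s" "\<And>s. Q s \<Longrightarrow> Q' s" "K \<le> K'" "d \<le> d'" "1 \<le> M"
  shows "triple M K' d' P' c Q'"
proof -
  have "K * M ^ d \<le> K' * M ^ d'"
    using assms by (intro mult_le_mono power_increasing) auto
  then show ?thesis
    using assms(1-3) unfolding triple_def by (meson order_trans)
qed

text \<open>Lets a proof name the values held in some cells before \<open>c\<close> as a fixed
  \<open>x\<close> and forget them afterwards.\<close>

lemma triple_ex:
  assumes "\<And>x. triple M K d (P x) c Q"
  shows "triple M K d (\<lambda>s. \<exists>x. P x s) c Q"
  using assms unfolding triple_def by blast

lemma triple_Seq:
  assumes "triple M K d P c Q" "triple M K' d Q c' Q'" "K + K' \<le> L"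
  shows "triple M L d P (Seq c c') Q'"
  unfolding triple_def
proof (intro allI impI)
  fix s assume "P s"
  then obtain T s' where 1: "exec c s T s'" "T \<le> K * M ^ d" "Q s'"
    using assms(1) unfolding triple_def by blast
  then obtain T' s'' where 2: "exec c' s' T' s''" "T' \<le> K' * M ^ d" "Q' s''"
    using assms(2) unfolding triple_def by blast
  have "T + T' \<le> (K + K') * M ^ d" using 1 2 by (simp add: distrib_right)
  also have "\<dots> \<le> L * M ^ d" using assms(3) by (rule mult_le_mono1)
  finally show "\<exists>T s'. exec (Seq c c') s T s' \<and> T \<le> L * M ^ d \<and> Q' s'"
    using exec.Seq[OF 1(1) 2(1)] 2(3) by blast
qed

lemma triple_Cond:
  assumes "triple M K d (\<lambda>s. P s \<and> bval b s) c Q" "triple M K d (\<lambda>s. P s \<and> \<not> bval b s) c' Q"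
    "Suc K \<le> L" "1 \<le> M"
  shows "triple M L d P (Cond b c c') Q"
  unfolding triple_def
proof (intro allI impI)
  fix s assume P: "P s"
  have "Suc (K * M ^ d) \<le> Suc K * M ^ d" using assms(4) by simp
  also have "\<dots> \<le> L * M ^ d" using assms(3) by (rule mult_le_mono1)
  finally have le: "Suc (K * M ^ d) \<le> L * M ^ d" .
  show "\<exists>T s'. exec (Cond b c c') s T s' \<and> T \<le> L * M ^ d \<and> Q s'"
  proof (cases "bval b s")
    case True
    then obtain T s' where "exec c s T s'" "T \<le> K * M ^ d" "Q s'"
      using assms(1) P unfolding triple_def by blast
    then show ?thesis using exec.CondTrue[OF True] le by (metis Suc_le_mono order_trans)
  next
    case False
    then obtain T s' where "exec c' s T s'" "T \<le> K * M ^ d" "Q s'"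
      using assms(2) P unfolding triple_def by blast
    then show ?thesis using exec.CondFalse[OF False] le by (metis Suc_le_mono order_trans)
  qed
qed

section \<open>Counting loops\<close>

abbreviation nvar :: "nat \<Rightarrow> nexp" where "nvar x \<equiv> NLoad x (NConst 0)"
abbreviation rvar :: "nat \<Rightarrow> rexp" where "rvar x \<equiv> RLoad x (NConst 0)"
abbreviation nset :: "nat \<Rightarrow> nexp \<Rightarrow> com" where "nset x \<equiv> NStore x (NConst 0)"
abbreviation rset :: "nat \<Rightarrow> rexp \<Rightarrow> com" where "rset x \<equiv> RStore x (NConst 0)"
definition NEq :: "nexp \<Rightarrow> nexp \<Rightarrow> bexp" where
  "NEq a b = BAnd (BNot (NLess a b)) (BNot (NLess b a))"

lemma bval_NEq [simp]: "bval (NEq a b) s \<longleftrightarrow> nval a s = nval b s"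
  by (auto simp: NEq_def)

definition For :: "nat \<Rightarrow> nexp \<Rightarrow> com \<Rightarrow> com" where
  "For x b c = Seq (nset x (NConst 0))
     (While (NLess (nvar x) b) (Seq c (nset x (NAdd (nvar x) (NConst 1)))))"

text \<open>\<open>Inv i\<close> describes the state after \<open>i\<close> rounds and must be
  insensitive to the counter (\<open>stable\<close>), whose value is tracked separately. Each round
  adds a test and an increment to the body; the strict \<open>N < M\<close> pays for the
  initialisation and the last test.\<close>

lemma triple_For:
  assumes body: "\<And>i. i < N \<Longrightarrow>
      triple M K d (\<lambda>s. Inv i s \<and> nmem s x 0 = i) c (\<lambda>s. Inv (Suc i) s \<and> nmem s x 0 = i)"
    and bound: "\<And>i s. Inv i s \<Longrightarrow> nval b s = N"
    and stable: "\<And>i s k. Inv i s \<Longrightarrow> Inv i (nstore x 0 k s)"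
    and N: "N < M" and L: "K + 2 \<le> L" and d': "d' = Suc d"
  shows "triple M L d' (Inv 0) (For x b c) (Inv N)"
  unfolding triple_def d'
proof (intro allI impI)
  let ?b = "NLess (nvar x) b" and ?c = "Seq c (nset x (NAdd (nvar x) (NConst 1)))"
  have loop: "\<exists>T s'. exec (While ?b ?c) s T s' \<and> T \<le> (N - i) * (K * M ^ d + 2) + 1 \<and> Inv N s'"
    if "Inv i s" "nmem s x 0 = i" "i \<le> N" for i s
    using that
  proof (induction "N - i" arbitrary: i s)
    case 0
    then have "i = N" by simp
    moreover have "\<not> bval ?b s" using 0 bound[OF 0(2)] by simp
    ultimately show ?case using exec.WhileFalse[of ?b s ?c] 0 by force
  next
    case (Suc n)
    then have i: "i < N" by simp
    obtain T s' where 1: "exec c s T s'" "T \<le> K * M ^ d" "Inv (Suc i) s'" "nmem s' x 0 = i"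
      using body[OF i] Suc.prems unfolding triple_def by blast
    let ?s = "nstore x 0 (Suc i) s'"
    have 2: "exec ?c s (T + 1) ?s"
      using exec.Seq[OF 1(1) exec.NStore[of x "NConst 0" "NAdd (nvar x) (NConst 1)" s']] 1(4) by simp
    have "Inv (Suc i) ?s" "nmem ?s x 0 = Suc i" using stable[OF 1(3)] by (auto simp: nstore_def)
    then obtain T' s'' where 3: "exec (While ?b ?c) ?s T' s''"
      "T' \<le> (N - Suc i) * (K * M ^ d + 2) + 1" "Inv N s''"
    proof -
      have "n = N - Suc i" "Suc i \<le> N" using Suc.hyps(2) i by auto
      then show thesis using Suc.hyps(1)[of "Suc i" ?s] \<open>Inv (Suc i) ?s\<close> \<open>nmem ?s x 0 = Suc i\<close> that
        by blast
    qed
    have "bval ?b s" using i Suc.prems bound[OF Suc.prems(1)] by simp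
    note ex = exec.WhileTrue[OF this 2 3(1)]
    have "N - i = Suc (N - Suc i)" using i by simp
    then have "Suc (T + 1 + T') \<le> (N - i) * (K * M ^ d + 2) + 1"
      using 1(2) 3(2) by simp
    then show ?case using ex 3(3) by blast
  qed
  fix s assume "Inv 0 s"
  then have "Inv 0 (nstore x 0 0 s)" by (rule stable)
  moreover have "nmem (nstore x 0 0 s) x 0 = 0" by (simp add: nstore_def)
  ultimately obtain T s' where 1: "exec (While ?b ?c) (nstore x 0 0 s) T s'"
    "T \<le> N * (K * M ^ d + 2) + 1" "Inv N s'"
    using loop[of 0 "nstore x 0 0 s"] by auto
  have "exec (For x b c) s (1 + T) s'"
    unfolding For_def
    using exec.Seq[OF exec.NStore[of x "NConst 0" "NConst 0" s]] 1(1) by simp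
  moreover have "1 + T \<le> L * M ^ Suc d"
  proof -
    obtain M' where M': "M = Suc M'" "N \<le> M'" using N by (cases M) auto
    have "1 + T \<le> M' * (K * M ^ d + 2) + 2"
      using 1(2) M' mult_le_mono1[of N M' "K * M ^ d + 2"] by linarith
    also have "\<dots> \<le> M * (K * M ^ d) + 2 * M" by (simp add: M'(1))
    also have "\<dots> \<le> M * (K * M ^ d) + 2 * (M * M ^ d)"
      using mult_le_mono2[of 1 "M ^ d" M] by (simp add: M'(1))
    also have "\<dots> = (K + 2) * M ^ Suc d" by (simp add: algebra_simps)
    also have "\<dots> \<le> L * M ^ Suc d" using L by (rule mult_le_mono1)
    finally show ?thesis .
  qed
  ultimately show "\<exists>T s'. exec (For x b c) s T s' \<and> T \<le> L * M ^ Suc d \<and> Inv N s'"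
    using 1(3) by blast
qed

lemma nmem_nstore [simp]:
  "nmem (nstore x i k s) y = (if y = x then (nmem s x)(i := k) else nmem s y)"
  "rmem (nstore x i k s) y = rmem s y"
  by (simp_all add: nstore_def)

lemma rmem_rstore [simp]:
  "rmem (rstore x i r s) y = (if y = x then (rmem s x)(i := r) else rmem s y)"
  "nmem (rstore x i r s) y = nmem s y"
  by (simp_all add: rstore_def)


section \<open>The greedy algorithm as a program\<close>

text \<open>
  Arrays beyond the input: \<open>nat\<close> 4 marks covered terminals; 5--8 and 13 are loop counters;
  9 flags adjacency of the terminal in 7 to the current star; 10 and real 3 hold the number of
  uncovered leaves and the cost of the current star; 11, real 4 and 12 hold those of the best star
  so far (11 is \<open>0\<close> if there is none) and an edge at its centre. Real 5 and 6 hold the products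
  by which two ratios are compared.
\<close>

definition eval_star :: com where
  "eval_star =
     Seq (nset 10 (NConst 0))
    (Seq (rset 3 (RLoad 1 (nvar 6)))
    (For 7 (NLoad 0 (NConst 0))
      (Seq (nset 9 (NConst 0))
      (Seq (For 8 (NLoad 0 (NConst 1))
             (Cond (BAnd (NEq (NLoad 2 (nvar 8)) (nvar 7))
                   (BAnd (NEq (NLoad 3 (nvar 8)) (NLoad 3 (nvar 6)))
                         (NLess (NLoad 4 (nvar 7)) (NConst 1))))
               (nset 9 (NConst 1)) Skip))
           (Cond (NLess (NConst 0) (nvar 9))
             (Seq (nset 10 (NAdd (nvar 10) (NConst 1)))
                  (rset 3 (RAdd (rvar 3) (RLoad 0 (nvar 6)))))
             Skip)))))"

text \<open>The machine cannot multiply, but one factor is always a leaf count or \<open>0\<close>,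
  so repeated addition takes linearly many rounds.\<close>

definition multiply :: "nat \<Rightarrow> nat \<Rightarrow> nat \<Rightarrow> com" where
  "multiply z x y = Seq (rset z (RConst 0)) (For 13 (nvar x) (rset z (RAdd (rvar z) (rvar y))))"

text \<open>Centres are visited through their edges, and only through edges with an uncovered leaf;
  every star evaluated therefore has a positive leaf count. Prices are compared after
  cross-multiplication, and ties keep the old star.\<close>

definition find_star :: com where
  "find_star =
     Seq (nset 11 (NConst 0))
    (For 6 (NLoad 0 (NConst 1))
      (Cond (NLess (NLoad 4 (NLoad 2 (nvar 6))) (NConst 1))
        (Seq eval_star
        (Seq (multiply 5 10 4)
        (Seq (multiply 6 11 3)
          (Cond (BAnd (NLess (NConst 0) (nvar 11)) (BNot (RLess (rvar 6) (rvar 5))))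
            Skip
            (Seq (nset 11 (nvar 10)) (Seq (rset 4 (rvar 3)) (nset 12 (nvar 6))))))))
        Skip))"

text \<open>Leaves are marked during the scan, so a parallel edge to a leaf just bought is
  skipped.\<close>

definition buy_star :: com where
  "buy_star =
     Seq (RStore 2 (NLoad 3 (nvar 12)) (RLoad 1 (nvar 12)))
    (For 8 (NLoad 0 (NConst 1))
      (Cond (BAnd (NEq (NLoad 3 (nvar 8)) (NLoad 3 (nvar 12)))
                  (NLess (NLoad 4 (NLoad 2 (nvar 8))) (NConst 1)))
        (Seq (RStore 2 (NLoad 2 (nvar 8)) (RLoad 0 (nvar 8)))
             (NStore 4 (NLoad 2 (nvar 8)) (NConst 1)))
        Skip))"

text \<open>One round per node suffices, since each round that finds a star covers a new terminal;
  further rounds find none and buy nothing.\<close>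

definition greedy :: com where
  "greedy = For 5 (NLoad 0 (NConst 0))
     (Seq find_star (Cond (NLess (NConst 0) (nvar 11)) buy_star Skip))"

section \<open>The correspondence between memory and instance\<close>

definition holds :: "aec \<Rightarrow> (nat \<Rightarrow> nat) \<Rightarrow> (nat \<Rightarrow> real) \<Rightarrow> state \<Rightarrow> bool" where
  "holds I C A s \<longleftrightarrow>
     nmem s 0 0 = num_nodes I \<and> nmem s 0 1 = length (edges I) \<and>
     (\<forall>j<length (edges I).
        nmem s 2 j = end_t (edges I ! j) \<and> nmem s 3 j = end_n (edges I ! j) \<and>
        rmem s 0 j = thr_t (edges I ! j) \<and> rmem s 1 j = thr_n (edges I ! j)) \<and>
     nmem s 4 = C \<and> rmem s 2 = A"

lemma holds_nstore [simp]:
  "x \<notin> {0, 2, 3, 4} \<Longrightarrow> holds I C A (nstore x i k s) \<longleftrightarrow> holds I C A s"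
  by (auto simp: holds_def)

lemma holds_rstore [simp]:
  "x \<notin> {0, 1, 2} \<Longrightarrow> holds I C A (rstore x i k s) \<longleftrightarrow> holds I C A s"
  by (auto simp: holds_def)

lemma holds_update:
  assumes "holds I C A s"
  shows "holds I (C(u := k)) A (nstore 4 u k s)" "holds I C (A(u := q)) (rstore 2 u q s)"
  using assms by (auto simp: holds_def)

lemma holds_init: "holds I (\<lambda>_. 0) (\<lambda>_. 0) (init I)"
  by (simp add: holds_def init_def)

lemma holdsD:
  assumes "holds I C A s"
  shows "nmem s 0 0 = num_nodes I" "nmem s 0 (Suc 0) = length (edges I)" "nmem s 4 = C" "rmem s 2 = A"
    "j < length (edges I) \<Longrightarrow> nmem s 2 j = end_t (edges I ! j)"
    "j < length (edges I) \<Longrightarrow> nmem s 3 j = end_n (edges I ! j)"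
    "j < length (edges I) \<Longrightarrow> rmem s 0 j = thr_t (edges I ! j)"
    "j < length (edges I) \<Longrightarrow> rmem s (Suc 0) j = thr_n (edges I ! j)"
  using assms by (simp_all add: holds_def)

definition uncovered :: "aec \<Rightarrow> (nat \<Rightarrow> nat) \<Rightarrow> nat set" where
  "uncovered I C = {u \<in> terminals I. C u = 0}"

lemma triple_multiply:
  assumes "z \<notin> {0, 1, 2, y}" "x \<noteq> 13" "c < M"
    and P_n: "\<And>s k. P (nstore 13 0 k s) = P s" and P_r: "\<And>s r. P (rstore z 0 r s) = P s"
  shows "triple M 4 1 (\<lambda>s. P s \<and> nmem s x 0 = c \<and> rmem s y 0 = r) (multiply z x y)
    (\<lambda>s. P s \<and> nmem s x 0 = c \<and> rmem s y 0 = r \<and> rmem s z 0 = real c * r)"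
proof -
  let ?Inv = "\<lambda>i s. P s \<and> nmem s x 0 = c \<and> rmem s y 0 = r \<and> rmem s z 0 = real i * r"
  have "triple M 3 1 (?Inv 0) (For 13 (nvar x) (rset z (RAdd (rvar z) (rvar y)))) (?Inv c)"
  proof (rule triple_For[where K = 1 and d = 0])
    show "triple M 1 0 (\<lambda>s. ?Inv i s \<and> nmem s 13 0 = i) (rset z (RAdd (rvar z) (rvar y)))
        (\<lambda>s. ?Inv (Suc i) s \<and> nmem s 13 0 = i)" for i
      by (rule triple_loop_free) (use assms in \<open>auto simp: P_r algebra_simps\<close>)
  qed (use assms in \<open>auto simp: P_n\<close>)
  moreover have "triple M 1 1 (\<lambda>s. P s \<and> nmem s x 0 = c \<and> rmem s y 0 = r) (rset z (RConst 0)) (?Inv 0)"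
    by (rule triple_loop_free) (use assms in \<open>auto simp: P_r\<close>)
  ultimately show ?thesis
    unfolding multiply_def by (intro triple_Seq[where K = 1 and K' = 3]) simp_all
qed

context uniform_instance
begin

abbreviation "n \<equiv> num_nodes I"
abbreviation "m \<equiv> length (edges I)"
text \<open>The successor makes both loop bounds, the numbers of nodes and of edges, strictly
  smaller than \<open>M\<close>, as \<open>triple_For\<close> demands.\<close>

abbreviation "M \<equiv> Suc (input_size I)"
abbreviation "leaf j \<equiv> end_t (edges I ! j)"
abbreviation "ctr j \<equiv> end_n (edges I ! j)"

lemma sizes_less: "n < M" "m < M" "1 \<le> M"
  by (simp_all add: input_size_def)

lemma nthD:
  assumes "j < m"
  shows "leaf j \<in> R" "ctr j \<in> S" "thr_t (edges I ! j) = t (ctr j)" "thr_n (edges I ! j) = w (ctr j)"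
    "0 \<le> t (ctr j)" "0 \<le> w (ctr j)" "leaf j \<in> nbrs I (ctr j)"
  using edgeD[OF nth_mem[OF assms]] nbrsI[OF nth_mem[OF assms]] by auto

lemma nbrs_iff: "u \<in> nbrs I v \<longleftrightarrow> (\<exists>i<m. leaf i = u \<and> ctr i = v)"
  by (auto simp: nbrs_def in_set_conv_nth image_iff)

abbreviation "leaves C v \<equiv> nbrs I v \<inter> uncovered I C"

lemma leaves_nodes: "leaves C v \<subseteq> {..<n}"
  using R_nodes by (auto simp: uncovered_def nodes_def)

lemma finite_leaves [simp]: "finite (leaves C v)"
  using leaves_nodes finite_subset by blast

lemma leaves_iff: "u \<in> leaves C v \<longleftrightarrow> (\<exists>i<m. leaf i = u \<and> ctr i = v \<and> C u = 0)"
  using nthD(1) by (auto simp: nbrs_iff uncovered_def)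

definition star_cost :: "(nat \<Rightarrow> nat) \<Rightarrow> nat \<Rightarrow> real" where
  "star_cost C v = w v + real (card (leaves C v)) * t v"

text \<open>What evaluating a star and multiplying leave intact: the instance, both outer counters
  and the record of the best star.\<close>

definition frame ::
  "(nat \<Rightarrow> nat) \<Rightarrow> (nat \<Rightarrow> real) \<Rightarrow> nat \<Rightarrow> nat \<Rightarrow> nat \<Rightarrow> nat \<Rightarrow> real \<Rightarrow> state \<Rightarrow> bool" where
  "frame C A r j bc bj bv s \<longleftrightarrow> holds I C A s \<and> nmem s 5 0 = r \<and> nmem s 6 0 = j \<and>
     nmem s 11 0 = bc \<and> nmem s 12 0 = bj \<and> rmem s 4 0 = bv"

lemma frame_store [simp]:
  "x \<notin> {0, 2, 3, 4, 5, 6, 11, 12} \<Longrightarrow>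
    frame C A r j bc bj bv (nstore x i k s) \<longleftrightarrow> frame C A r j bc bj bv s"
  "x \<notin> {0, 1, 2, 4} \<Longrightarrow>
    frame C A r j bc bj bv (rstore x i q s) \<longleftrightarrow> frame C A r j bc bj bv s"
  by (auto simp: frame_def)

text \<open>Leaves are counted by nodes, with an inner scan of all edges deciding adjacency, so
  parallel edges do not inflate the count. The nested loops give the exponent 2.\<close>

lemma triple_eval_star:
  assumes j: "j < m"
  shows "triple M 15 2 (frame C A r j bc bj bv) eval_star
    (\<lambda>s. frame C A r j bc bj bv s \<and> nmem s 10 0 = card (leaves C (ctr j)) \<and>
         rmem s 3 0 = star_cost C (ctr j))"
proof -
  let ?test = "Cond (BAnd (NEq (NLoad 2 (nvar 8)) (nvar 7))
      (BAnd (NEq (NLoad 3 (nvar 8)) (NLoad 3 (nvar 6))) (NLess (NLoad 4 (nvar 7)) (NConst 1))))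
    (nset 9 (NConst 1)) Skip"
  let ?scan = "For 8 (NLoad 0 (NConst 1)) ?test"
  let ?count = "Cond (NLess (NConst 0) (nvar 9))
    (Seq (nset 10 (NAdd (nvar 10) (NConst 1))) (rset 3 (RAdd (rvar 3) (RLoad 0 (nvar 6))))) Skip"
  define L where "L u = leaves C (ctr j) \<inter> {..<u}" for u
  define Inv where "Inv u s \<longleftrightarrow> frame C A r j bc bj bv s \<and> nmem s 10 0 = card (L u) \<and>
      rmem s 3 0 = w (ctr j) + real (card (L u)) * t (ctr j)" for u s
  define Inv' where "Inv' u i s \<longleftrightarrow> Inv u s \<and> nmem s 7 0 = u \<and>
      nmem s 9 0 = (if \<exists>i'<i. leaf i' = u \<and> ctr i' = ctr j \<and> C u = 0 then 1 else 0)" for u i s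
  have L_Suc: "L (Suc u) = (if u \<in> leaves C (ctr j) then insert u (L u) else L u)" for u
    by (auto simp: L_def less_Suc_eq)
  have L_card: "card (L (Suc u)) = card (L u) + (if u \<in> leaves C (ctr j) then 1 else 0)" for u
    unfolding L_Suc by (simp add: L_def)
  have inner: "triple M 5 1 (Inv' u 0) ?scan (Inv' u m)" for u
  proof (rule triple_For[where K = 3 and d = 0])
    fix i assume i: "i < m"
    show "triple M 3 0 (\<lambda>s. Inv' u i s \<and> nmem s 8 0 = i) ?test (\<lambda>s. Inv' u (Suc i) s \<and> nmem s 8 0 = i)"
      by (rule triple_loop_free)
        (use i j in \<open>auto simp: Inv'_def Inv_def frame_def holdsD less_Suc_eq\<close>)
  qed (use sizes_less in \<open>auto simp: Inv'_def Inv_def frame_def holdsD\<close>)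
  have "triple M 12 2 (Inv 0) (For 7 (NLoad 0 (NConst 0))
      (Seq (nset 9 (NConst 0)) (Seq ?scan ?count))) (Inv n)"
  proof (rule triple_For[where K = 10 and d = 1], goal_cases)
    case (1 u)
    show ?case
    proof (rule triple_Seq[where K = 1 and K' = 9])
      show "triple M 1 1 (\<lambda>s. Inv u s \<and> nmem s 7 0 = u) (nset 9 (NConst 0)) (Inv' u 0)"
        by (rule triple_loop_free) (auto simp: Inv'_def Inv_def)
      show "triple M 9 1 (Inv' u 0) (Seq ?scan ?count)
        (\<lambda>s. Inv (Suc u) s \<and> nmem s 7 0 = u)"
      proof (rule triple_Seq[OF inner])
        show "triple M 4 1 (Inv' u m) ?count (\<lambda>s. Inv (Suc u) s \<and> nmem s 7 0 = u)"
        proof (rule triple_loop_free, goal_cases)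
          case (2 s)
          then have 3: "Inv u s" "nmem s 7 0 = u"
            "nmem s 9 0 = (if u \<in> leaves C (ctr j) then 1 else 0)"
            unfolding Inv'_def leaves_iff by simp_all
          then show ?case
            using j by (auto simp: Inv_def L_card algebra_simps frame_def holdsD nthD)
        qed auto
      qed simp
    qed simp
  qed (use sizes_less in \<open>auto simp: Inv_def frame_def holdsD\<close>)
  moreover have "triple M 1 2 (frame C A r j bc bj bv) (nset 10 (NConst 0))
      (\<lambda>s. frame C A r j bc bj bv s \<and> nmem s 10 0 = 0)"
    by (rule triple_loop_free) auto
  moreover have "triple M 1 2 (\<lambda>s. frame C A r j bc bj bv s \<and> nmem s 10 0 = 0)
      (rset 3 (RLoad 1 (nvar 6))) (Inv 0)"
    by (rule triple_loop_free) (use j in \<open>auto simp: Inv_def L_def frame_def holdsD nthD\<close>)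
  ultimately have "triple M 15 2 (frame C A r j bc bj bv) eval_star (Inv n)"
    unfolding eval_star_def
    by (intro triple_Seq[where K = 1 and K' = 14] triple_Seq[where K = 1 and K' = 12]) simp_all
  moreover have "L n = leaves C (ctr j)" using leaves_nodes by (auto simp: L_def)
  ultimately show ?thesis
    by (simp add: Inv_def[abs_def] star_cost_def)
qed

section \<open>Comparing stars and choosing the cheapest\<close>

lemma star_price_eq:
  assumes "leaves C v \<noteq> {}"
  shows "star_price I w t (uncovered I C) v = star_cost C v / real (card (leaves C v))"
  using assms by (simp add: star_price_def star_cost_def field_simps)

lemma star_price_le_iff:
  assumes "leaves C v \<noteq> {}" "leaves C v' \<noteq> {}"
  shows "star_price I w t (uncovered I C) v \<le> star_price I w t (uncovered I C) v' \<longleftrightarrow>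
    real (card (leaves C v')) * star_cost C v \<le> real (card (leaves C v)) * star_cost C v'"
proof -
  have "0 < card (leaves C v)" "0 < card (leaves C v')"
    using assms by (auto simp: card_gt_0_iff)
  then show ?thesis
    unfolding star_price_eq[OF assms(1)] star_price_eq[OF assms(2)]
    by (simp add: pos_divide_le_eq pos_le_divide_eq mult.commute)
qed

text \<open>\<open>bc = 0\<close> can encode that no star was found, because every recorded star has
  an uncovered leaf. Competitors are listed by the edges scanned so far.\<close>

definition best :: "(nat \<Rightarrow> nat) \<Rightarrow> nat \<Rightarrow> nat \<Rightarrow> nat \<Rightarrow> real \<Rightarrow> bool" where
  "best C j bc bj bv \<longleftrightarrow>
     (if bc = 0 then \<forall>i<j. leaf i \<notin> uncovered I C
      else bj < m \<and> bc = card (leaves C (ctr bj)) \<and> bv = star_cost C (ctr bj) \<and>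
        (\<forall>i<j. leaf i \<in> uncovered I C \<longrightarrow>
          star_price I w t (uncovered I C) (ctr bj) \<le> star_price I w t (uncovered I C) (ctr i)))"

lemma best_covered:
  assumes "best C j bc bj bv" "leaf j \<notin> uncovered I C"
  shows "best C (Suc j) bc bj bv"
  using assms by (auto simp: best_def less_Suc_eq split: if_splits)

lemma best_keep:
  assumes "best C j bc bj bv" "j < m" "leaf j \<in> uncovered I C" "0 < bc"
    "real (card (leaves C (ctr j))) * bv \<le> real bc * star_cost C (ctr j)"
  shows "best C (Suc j) bc bj bv"
proof -
  have bj: "bc = card (leaves C (ctr bj))" "bv = star_cost C (ctr bj)"
    using assms by (auto simp: best_def)
  have "leaves C (ctr j) \<noteq> {}" using nthD(7)[OF assms(2)] assms(3) by auto
  moreover have "leaves C (ctr bj) \<noteq> {}" using bj assms(4) by (metis card.empty less_irrefl)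
  ultimately have "star_price I w t (uncovered I C) (ctr bj) \<le> star_price I w t (uncovered I C) (ctr j)"
    using assms(5) bj by (simp add: star_price_le_iff)
  then show ?thesis using assms(1,4) by (auto simp: best_def less_Suc_eq)
qed

text \<open>The new star undercuts the recorded one, hence by transitivity all earlier ones; if
  nothing was recorded, no earlier edge had an uncovered leaf.\<close>

lemma best_replace:
  assumes "best C j bc bj bv" "j < m" "leaf j \<in> uncovered I C"
    "bc = 0 \<or> real bc * star_cost C (ctr j) < real (card (leaves C (ctr j))) * bv"
  shows "best C (Suc j) (card (leaves C (ctr j))) j (star_cost C (ctr j))"
proof -
  have ne: "leaves C (ctr j) \<noteq> {}" using nthD(7)[OF assms(2)] assms(3) by auto
  have "star_price I w t (uncovered I C) (ctr j) \<le> star_price I w t (uncovered I C) (ctr i)"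
    if i: "i < j" "leaf i \<in> uncovered I C" for i
  proof (cases "bc = 0")
    case True
    then show ?thesis using assms(1) i by (auto simp: best_def)
  next
    case False
    then have bj: "bc = card (leaves C (ctr bj))" "bv = star_cost C (ctr bj)"
      using assms by (auto simp: best_def)
    have "leaves C (ctr bj) \<noteq> {}" using bj False by (metis card.empty)
    then have "star_price I w t (uncovered I C) (ctr j) \<le> star_price I w t (uncovered I C) (ctr bj)"
      using assms(4) ne bj False by (simp add: star_price_le_iff)
    also have "\<dots> \<le> star_price I w t (uncovered I C) (ctr i)"
      using assms(1) i False by (auto simp: best_def)
    finally show ?thesis .
  qed
  then show ?thesis using ne assms(2) by (auto simp: best_def less_Suc_eq)
qed

text \<open>Every star with an uncovered leaf is met at the edge to that leaf, so a minimum over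
  edges is one over all centres.\<close>

lemma best_cheapest:
  assumes "best C m bc bj bv" "0 < bc"
  shows "bj < m" "cheapest I w t (uncovered I C) (ctr bj)"
proof -
  show "bj < m" using assms by (simp add: best_def)
  have "bc = card (leaves C (ctr bj))" using assms by (simp add: best_def)
  then have "leaves C (ctr bj) \<noteq> {}" using assms(2) by (metis card.empty less_irrefl)
  moreover have "star_price I w t (uncovered I C) (ctr bj) \<le> star_price I w t (uncovered I C) v"
    if "leaves C v \<noteq> {}" for v
  proof -
    from that obtain u where u: "u \<in> nbrs I v" "u \<in> uncovered I C" by auto
    from u(1) obtain i where "i < m" "leaf i = u" "ctr i = v" unfolding nbrs_iff by auto
    moreover have "\<forall>i<m. leaf i \<in> uncovered I C \<longrightarrow>
        star_price I w t (uncovered I C) (ctr bj) \<le> star_price I w t (uncovered I C) (ctr i)"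
      using assms by (simp add: best_def)
    ultimately show ?thesis using u(2) by auto
  qed
  ultimately show "cheapest I w t (uncovered I C) (ctr bj)" by (simp add: cheapest_def)
qed

lemma best_none:
  assumes "best C m 0 bj bv"
  shows "leaves C v = {}"
  using assms nbrs_iff by (fastforce simp: best_def)

lemma card_leaves_less: "card (leaves C v) < M"
  using card_mono[OF _ leaves_nodes[of v C]] sizes_less by simp

lemma triple_find_star:
  "triple M 34 3 (\<lambda>s. holds I C A s \<and> nmem s 5 0 = r) find_star
    (\<lambda>s. holds I C A s \<and> nmem s 5 0 = r \<and> best C m (nmem s 11 0) (nmem s 12 0) (rmem s 4 0))"
proof -
  define Inv where "Inv j s \<longleftrightarrow> holds I C A s \<and> nmem s 5 0 = r \<and>
      best C j (nmem s 11 0) (nmem s 12 0) (rmem s 4 0)" for j s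
  let ?upd = "Cond (BAnd (NLess (NConst 0) (nvar 11)) (BNot (RLess (rvar 6) (rvar 5))))
            Skip
            (Seq (nset 11 (nvar 10)) (Seq (rset 4 (rvar 3)) (nset 12 (nvar 6))))"
  let ?body = "Cond (NLess (NLoad 4 (NLoad 2 (nvar 6))) (NConst 1))
        (Seq eval_star (Seq (multiply 5 10 4) (Seq (multiply 6 11 3) ?upd))) Skip"
  have body: "triple M 30 2 (\<lambda>s. frame C A r j bc bj bv s \<and> best C j bc bj bv) ?body
      (\<lambda>s. Inv (Suc j) s \<and> nmem s 6 0 = j)" if j: "j < m" for j bc bj bv
  proof (rule triple_Cond[where K = 29])
    let ?F = "frame C A r j bc bj bv"
    let ?c = "card (leaves C (ctr j))" and ?v = "star_cost C (ctr j)"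
    show "triple M 29 2 (\<lambda>s. (?F s \<and> best C j bc bj bv) \<and>
        \<not> bval (NLess (NLoad 4 (NLoad 2 (nvar 6))) (NConst 1)) s) Skip
        (\<lambda>s. Inv (Suc j) s \<and> nmem s 6 0 = j)"
      by (rule triple_loop_free)
        (use j in \<open>auto simp: Inv_def frame_def holdsD uncovered_def intro!: best_covered\<close>)
    show "triple M 29 2 (\<lambda>s. (?F s \<and> best C j bc bj bv) \<and>
        bval (NLess (NLoad 4 (NLoad 2 (nvar 6))) (NConst 1)) s)
        (Seq eval_star (Seq (multiply 5 10 4) (Seq (multiply 6 11 3) ?upd)))
        (\<lambda>s. Inv (Suc j) s \<and> nmem s 6 0 = j)"
    \<comment> \<open>These are facts about logical variables only; if they fail, the precondition
      is unsatisfiable and the triple vacuous.\<close>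
    proof (cases "best C j bc bj bv \<and> C (leaf j) = 0")
      case False
      then show ?thesis
        using j by (auto simp: triple_def frame_def holdsD)
    next
      case True
      then have unc: "leaf j \<in> uncovered I C" using nthD(1)[OF j] by (simp add: uncovered_def)
      have bc: "bc < M" using True card_leaves_less by (auto simp: best_def split: if_splits)
      \<comment> \<open>The conjuncts are regrouped between commands so that each multiplication
        sees its frame \<open>P\<close> and its two operands.\<close>
      have 1: "triple M 15 2 ?F eval_star (\<lambda>s. (?F s \<and> rmem s 3 0 = ?v) \<and> nmem s 10 0 = ?c \<and> rmem s 4 0 = bv)"
        by (rule triple_conseq[OF triple_eval_star[OF j, of C A r bc bj bv]]) (auto simp: frame_def)
      have 2: "triple M 4 2 (\<lambda>s. (?F s \<and> rmem s 3 0 = ?v) \<and> nmem s 10 0 = ?c \<and> rmem s 4 0 = bv)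
          (multiply 5 10 4)
          (\<lambda>s. (?F s \<and> nmem s 10 0 = ?c \<and> rmem s 5 0 = real ?c * bv) \<and> nmem s 11 0 = bc \<and> rmem s 3 0 = ?v)"
        by (rule triple_conseq[OF triple_multiply[where c = ?c and r = bv
                and P = "\<lambda>s. ?F s \<and> rmem s 3 0 = ?v"]])
          (use card_leaves_less in \<open>auto simp: frame_def\<close>)
      have 3: "triple M 4 2
          (\<lambda>s. (?F s \<and> nmem s 10 0 = ?c \<and> rmem s 5 0 = real ?c * bv) \<and> nmem s 11 0 = bc \<and> rmem s 3 0 = ?v)
          (multiply 6 11 3)
          (\<lambda>s. ?F s \<and> nmem s 10 0 = ?c \<and> rmem s 3 0 = ?v \<and> rmem s 5 0 = real ?c * bv \<and>
             rmem s 6 0 = real bc * ?v)"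
        by (rule triple_conseq[OF triple_multiply[where c = bc and r = ?v
                and P = "\<lambda>s. ?F s \<and> nmem s 10 0 = ?c \<and> rmem s 5 0 = real ?c * bv"]])
          (use bc in auto)
      have 4: "triple M 5 2
          (\<lambda>s. ?F s \<and> nmem s 10 0 = ?c \<and> rmem s 3 0 = ?v \<and> rmem s 5 0 = real ?c * bv \<and>
             rmem s 6 0 = real bc * ?v) ?upd (\<lambda>s. Inv (Suc j) s \<and> nmem s 6 0 = j)"
      proof (rule triple_loop_free, goal_cases)
        case (2 s)
        show ?case
        proof (cases "0 < bc \<and> real ?c * bv \<le> real bc * ?v")
          case keep: True
          then have "best C (Suc j) bc bj bv" using best_keep True j unc by blast
          then show ?thesis using 2 keep by (simp add: Inv_def frame_def)
        next
          case False
          then have "best C (Suc j) ?c j ?v"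
            by (intro best_replace[of C j bc bj bv]) (use True j unc in auto)
          moreover have "run ?upd s = nstore 12 0 j (rstore 4 0 ?v (nstore 11 0 ?c s))"
            using 2 False by (auto simp: frame_def)
          ultimately show ?thesis using 2 by (simp add: Inv_def frame_def)
        qed
      qed auto
      show ?thesis
        by (rule triple_conseq[OF triple_Seq[OF 1 triple_Seq[OF 2
                triple_Seq[OF 3 4 order.refl] order.refl] order.refl]]) auto
    qed
  qed auto
  have "triple M 32 3 (Inv 0) (For 6 (NLoad 0 (NConst 1)) ?body) (Inv m)"
  proof (rule triple_For[where K = 30 and d = 2], goal_cases)
    case (1 j)
    have "triple M 30 2 (\<lambda>s. \<exists>bc bj bv. frame C A r j bc bj bv s \<and> best C j bc bj bv) ?body
      (\<lambda>s. Inv (Suc j) s \<and> nmem s 6 0 = j)"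
      by (intro triple_ex body[OF 1])
    then show ?case
      by (rule triple_conseq) (auto simp: Inv_def frame_def)
  qed (use sizes_less in \<open>auto simp: Inv_def holdsD\<close>)
  moreover have "triple M 1 3 (\<lambda>s. holds I C A s \<and> nmem s 5 0 = r) (nset 11 (NConst 0)) (Inv 0)"
    by (rule triple_loop_free) (auto simp: Inv_def best_def)
  ultimately have "triple M 34 3 (\<lambda>s. holds I C A s \<and> nmem s 5 0 = r) find_star (Inv m)"
    unfolding find_star_def by (intro triple_Seq[where K = 1 and K' = 32]) simp_all
  then show ?thesis by (simp add: Inv_def[abs_def])
qed

lemma triple_buy_star:
  assumes bj: "bj < m"
  shows "triple M 8 1 (\<lambda>s. holds I C A s \<and> nmem s 5 0 = r \<and> nmem s 12 0 = bj) buy_star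
    (\<lambda>s. holds I (\<lambda>u. if u \<in> leaves C (ctr bj) then 1 else C u)
       (\<lambda>x. if x \<in> leaves C (ctr bj) then t (ctr bj) else if x = ctr bj then w (ctr bj) else A x) s \<and>
       nmem s 5 0 = r)"
proof -
  \<comment> \<open>The leaves bought after \<open>i\<close> edges, expressed by the original marks
    \<open>C\<close>; the program tests the current marks \<open>C' i\<close> instead.\<close>
  define D where "D i = {u. \<exists>k<i. leaf k = u \<and> ctr k = ctr bj \<and> C u = 0}" for i
  define C' where "C' i = (\<lambda>u. if u \<in> D i then 1 else C u)" for i
  define A' where "A' i = (\<lambda>x. if x \<in> D i then t (ctr bj) else if x = ctr bj then w (ctr bj) else A x)" for i
  define Inv where "Inv i s \<longleftrightarrow> holds I (C' i) (A' i) s \<and> nmem s 5 0 = r \<and> nmem s 12 0 = bj" for i s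
  have D_Suc: "D (Suc i) = (if ctr i = ctr bj \<and> C (leaf i) = 0 then insert (leaf i) (D i) else D i)" for i
    by (auto simp: D_def less_Suc_eq)
  let ?body = "Cond (BAnd (NEq (NLoad 3 (nvar 8)) (NLoad 3 (nvar 12)))
                  (NLess (NLoad 4 (NLoad 2 (nvar 8))) (NConst 1)))
        (Seq (RStore 2 (NLoad 2 (nvar 8)) (RLoad 0 (nvar 8)))
             (NStore 4 (NLoad 2 (nvar 8)) (NConst 1)))
        Skip"
  have "triple M 7 1 (Inv 0) (For 8 (NLoad 0 (NConst 1)) ?body) (Inv m)"
  proof (rule triple_For[where K = 5 and d = 0], goal_cases)
    case (1 i)
    show ?case
    proof (rule triple_loop_free, goal_cases)
      case (2 s)
      then have s: "holds I (C' i) (A' i) s" "nmem s 5 0 = r" "nmem s 12 0 = bj" "nmem s 8 0 = i"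
        by (auto simp: Inv_def)
      show ?case
      proof (cases "ctr i = ctr bj \<and> C' i (leaf i) = 0")
        case True
        then have "C (leaf i) = 0" by (auto simp: C'_def split: if_splits)
        then have eq: "C' (Suc i) = (C' i)(leaf i := 1)" "A' (Suc i) = (A' i)(leaf i := t (ctr bj))"
          using True by (auto simp: C'_def A'_def D_Suc)
        have "run ?body s = nstore 4 (leaf i) 1 (rstore 2 (leaf i) (t (ctr bj)) s)"
          using s True 1 bj by (simp add: holdsD[OF s(1)] nthD)
        then show ?thesis
          using s by (simp only: Inv_def eq) (simp add: holds_update del: fun_upd_apply)
      next
        \<comment> \<open>The edge belongs to another star, or its leaf was covered before, or an
          earlier parallel edge has put it into \<open>D i\<close>.\<close>
        case False
        then have "D (Suc i) = D i" by (auto simp: C'_def D_Suc split: if_splits)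
        then have eq: "C' (Suc i) = C' i" "A' (Suc i) = A' i" by (simp_all add: C'_def A'_def)
        have "run ?body s = s"
          using s False 1 bj by (auto simp: holdsD[OF s(1)])
        then show ?thesis using s by (simp only: Inv_def eq)
      qed
    qed auto
  qed (use sizes_less in \<open>auto simp: Inv_def holdsD\<close>)
  moreover have "triple M 1 1 (\<lambda>s. holds I C A s \<and> nmem s 5 0 = r \<and> nmem s 12 0 = bj)
      (RStore 2 (NLoad 3 (nvar 12)) (RLoad 1 (nvar 12))) (Inv 0)"
  proof (rule triple_loop_free, goal_cases)
    case (2 s)
    have eq: "C' 0 = C" "A' 0 = A(ctr bj := w (ctr bj))"
      by (auto simp: C'_def A'_def D_def)
    show ?case
      using 2 bj holdsD(6,8)[of I C A s bj]
      by (simp add: Inv_def eq nthD holds_update del: fun_upd_apply)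
  qed auto
  ultimately have "triple M 8 1 (\<lambda>s. holds I C A s \<and> nmem s 5 0 = r \<and> nmem s 12 0 = bj)
      buy_star (Inv m)"
    unfolding buy_star_def by (intro triple_Seq[where K = 1 and K' = 7]) simp_all
  moreover have "D m = leaves C (ctr bj)"
    unfolding D_def using leaves_iff by blast
  ultimately show ?thesis
    by (simp add: Inv_def[abs_def] C'_def A'_def) (erule triple_conseq, simp_all)
qed

text \<open>The invariant allows at most \<open>n - r\<close> uncovered terminals before round
  \<open>r\<close>, so none remain after \<open>n\<close> rounds. Four nested loops, over rounds,
  edges, nodes and again edges, give the exponent 4.\<close>

lemma triple_greedy:
  assumes cov: "\<And>u. u \<in> R \<Longrightarrow> \<exists>v. u \<in> nbrs I v"
  shows "triple M 46 4 (\<lambda>s. holds I (\<lambda>_. 0) (\<lambda>_. 0) s) greedy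
    (\<lambda>s. greedy_inv {} (rmem s 2))"
proof -
  define Inv where "Inv r s \<longleftrightarrow> (\<exists>C A. holds I C A s \<and> greedy_inv (uncovered I C) A \<and>
      card (uncovered I C) \<le> n - r)" for r s
  let ?body = "Seq find_star (Cond (NLess (NConst 0) (nvar 11)) buy_star Skip)"
  have fin: "finite (uncovered I C)" for C by (simp add: uncovered_def)
  have body: "triple M 44 3 (\<lambda>s. holds I C A s \<and> nmem s 5 0 = r) ?body (\<lambda>s. Inv (Suc r) s \<and> nmem s 5 0 = r)"
    if inv: "greedy_inv (uncovered I C) A" and le: "card (uncovered I C) \<le> n - r" for C A r
  proof (rule triple_Seq[OF triple_find_star triple_Cond[where K = 9]])
    let ?Q = "\<lambda>s. holds I C A s \<and> nmem s 5 0 = r \<and> best C m (nmem s 11 0) (nmem s 12 0) (rmem s 4 0)"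
    have "triple M 9 3 (\<lambda>s. \<exists>bj. (holds I C A s \<and> nmem s 5 0 = r \<and> nmem s 12 0 = bj) \<and>
        (bj < m \<and> cheapest I w t (uncovered I C) (ctr bj))) buy_star
        (\<lambda>s. Inv (Suc r) s \<and> nmem s 5 0 = r)"
    proof (rule triple_ex)
      fix bj
      show "triple M 9 3 (\<lambda>s. (holds I C A s \<and> nmem s 5 0 = r \<and> nmem s 12 0 = bj) \<and>
        (bj < m \<and> cheapest I w t (uncovered I C) (ctr bj))) buy_star
        (\<lambda>s. Inv (Suc r) s \<and> nmem s 5 0 = r)"
      proof (cases "bj < m \<and> cheapest I w t (uncovered I C) (ctr bj)")
        case True
        let ?D = "leaves C (ctr bj)"
        let ?C = "\<lambda>u. if u \<in> ?D then 1 else C u"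
        let ?A = "\<lambda>x. if x \<in> ?D then t (ctr bj) else if x = ctr bj then w (ctr bj) else A x"
        have U: "uncovered I ?C = uncovered I C - nbrs I (ctr bj)"
          by (auto simp: uncovered_def)
        have "greedy_inv (uncovered I ?C) ?A"
          unfolding U by (rule greedy_inv_step[OF inv]) (use True in auto)
        moreover have "card (uncovered I ?C) < card (uncovered I C)"
          unfolding U using True fin by (intro psubset_card_mono) (auto simp: cheapest_def)
        ultimately have "Inv (Suc r) s" if "holds I ?C ?A s" for s
          unfolding Inv_def using le that by (intro exI[of _ ?C] exI[of _ ?A]) linarith
        then show ?thesis
          using True by (intro triple_conseq[OF triple_buy_star[of bj C A r]]) auto
      qed (auto simp: triple_def)
    qed
    then show "triple M 9 3 (\<lambda>s. ?Q s \<and> bval (NLess (NConst 0) (nvar 11)) s) buy_star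
        (\<lambda>s. Inv (Suc r) s \<and> nmem s 5 0 = r)"
      by (rule triple_conseq) (use best_cheapest in fastforce)+
    show "triple M 9 3 (\<lambda>s. ?Q s \<and> \<not> bval (NLess (NConst 0) (nvar 11)) s) Skip
        (\<lambda>s. Inv (Suc r) s \<and> nmem s 5 0 = r)"
    proof (rule triple_loop_free, goal_cases)
      case (2 s)
      then have "best C m 0 (nmem s 12 0) (rmem s 4 0)" by auto
      then have "leaves C v = {}" for v by (rule best_none)
      \<comment> \<open>Every terminal has a neighbour by \<open>cov\<close>, so if no star has an
        uncovered leaf, everything is covered.\<close>
      then have "uncovered I C = {}" using cov by (fastforce simp: uncovered_def)
      then show ?case using 2 inv by (auto simp: Inv_def intro!: exI[of _ C])
    qed auto
  qed auto
  have "triple M 46 4 (Inv 0) greedy (Inv n)"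
    unfolding greedy_def
  proof (rule triple_For[where K = 44 and d = 3], goal_cases)
    case (1 r)
    have "triple M 44 3 (\<lambda>s. \<exists>C A. (holds I C A s \<and> nmem s 5 0 = r) \<and>
        greedy_inv (uncovered I C) A \<and> card (uncovered I C) \<le> n - r) ?body
        (\<lambda>s. Inv (Suc r) s \<and> nmem s 5 0 = r)"
      using body unfolding triple_def by blast
    then show ?case by (rule triple_conseq) (auto simp: Inv_def)
  qed (use sizes_less in \<open>auto simp: Inv_def holdsD\<close>)
  then show ?thesis
  proof (rule triple_conseq)
    show "Inv 0 s" if "holds I (\<lambda>_. 0) (\<lambda>_. 0) s" for s
    proof -
      have "uncovered I (\<lambda>_. 0) = R" by (simp add: uncovered_def)
      moreover have "card R \<le> n" using card_mono[OF finite_nodes R_nodes] by (simp add: nodes_def)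
      ultimately show ?thesis
        using that greedy_inv_start unfolding Inv_def by (metis diff_zero)
    qed
    show "greedy_inv {} (rmem s 2)" if inv: "Inv n s" for s
    proof -
      obtain C A where "holds I C A s" "greedy_inv (uncovered I C) A" "card (uncovered I C) = 0"
        using inv by (auto simp: Inv_def)
      then show ?thesis using fin by (simp add: holdsD)
    qed
  qed auto
qed

end

theorem theorem2:
  shows "\<exists>(c::com) (p::nat poly). \<forall>\<theta>::real. \<theta> > 0 \<longrightarrow>
    approximates c p (locally_uniform_aec \<theta>) (1 + omega_bar \<theta>)"
proof (intro exI allI impI)
  fix \<theta> :: real assume \<theta>: "\<theta> > 0"
  \<comment> \<open>The polynomial is \<open>46 * (1 + x) ^ 4\<close>, the bound of
    \<open>triple_greedy\<close> with \<open>M = 1 + input_size I\<close>; neither it nor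
    \<open>greedy\<close> depends on \<theta>.\<close>
  show "approximates greedy ([:46:] * [:1, 1:] ^ 4) (locally_uniform_aec \<theta>) (1 + omega_bar \<theta>)"
    unfolding approximates_def
  proof (intro ballI impI)
    fix I assume "I \<in> locally_uniform_aec \<theta>" and feas: "\<exists>a. feasible I a"
    then obtain w t where I: "bipartite_aec I" "locally_uniform I w t" "slope_at_most I w t \<theta>"
      by (auto simp: locally_uniform_aec_def)
    \<comment> \<open>\<open>w\<close> and \<open>t\<close> enter the analysis only; the program
      reads the thresholds off the edges.\<close>
    interpret uniform_instance I w t by unfold_locales (use I in auto)
    have "\<exists>v. u \<in> nbrs I v" if u: "u \<in> R" for u
    proof -
      obtain a e where "e \<in> activated I a" "u = end_t e \<or> u = end_n e"
        using feas u by (auto simp: feasible_def covers_def)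
      then have "e \<in> set (edges I)" "u = end_t e"
        using u edgeD(2) by (auto simp: activated_def)
      then show ?thesis using nbrsI by blast
    qed
    from triple_greedy[OF this] obtain T s where
      "exec greedy (init I) T s" "T \<le> 46 * M ^ 4" "greedy_inv {} (rmem s 2)"
      unfolding triple_def using holds_init by blast
    then show "\<exists>T s. exec greedy (init I) T s \<and> T \<le> poly ([:46:] * [:1, 1:] ^ 4) (input_size I) \<and>
        feasible I (result s) \<and> cost I (result s) \<le> (1 + omega_bar \<theta>) * opt I"
      using greedy_inv_feasible greedy_inv_opt[OF _ I(3) \<theta>]
      by (intro exI[of _ T] exI[of _ s]) (simp add: result_def)
  qed
qed

end
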